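(* Let $G$ be a finite connected graph (multiple edges and self-loops allowed) with edge set $E$, and let $T\subset G$ be a spanning tree of $G$ (identified with its set of edges). Let $w(G,T)=N(G,T)/|E|!$, where $N(G,T)$ is the number of total orderings $\sigma$ of $E$ whose leading tree $T(\sigma)$ (the spanning tree selected by Kruskal's greedy algorithm applied to the edges in the order $\sigma$) equals $T$. Then $$ w(G,T)=\int_{[0,1]^{T}}\ \prod_{\ell\in T}dw_\ell\ \prod_{\ell\in E\setminus T}x^{T}_{\ell}(\{w\}),$$ where, for $\ell\in E\setminus T$ and $\{w\}=(w_{\ell'})_{\ell'\in T}\in[0,1]^T$, $x^{T}_{\ell}(\{w\})=\min_{\ell'\in P^T_\ell}w_{\ell'}$ is the minimum of the parameters $w_{\ell'}$ over the edges $\ell'$ of the unique path $P^T_\ell$ in $T$ joining the two ends of $\ell$, and $x^{T}_{\ell}(\{w\})=1$ if $\ell$ is a self-loop (so that the path is empty).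
   Context: Graphs are finite and may have multiple edges and self-loops. For a connected graph $G$ with edge set $E$, a Hepp sector is a total ordering $\sigma=(\sigma(1),\dots,\sigma(|E|))$ of $E$; there are $|E|!$ of them. For a sector $\sigma$, the leading tree $T(\sigma)$ is the spanning tree produced by Kruskal's greedy algorithm: go through the edges in the order $\sigma(1),\sigma(2),\dots,\sigma(|E|)$, and pick an edge if and only if it does not create a cycle together with the previously picked edges (a self-loop counts as a cycle, so it is never picked); $T(\sigma)$ is the set of picked edges. Equivalently, $T(\sigma)$ is the spanning tree of $G$ minimizing the sum of the positions in $\sigma$ of its edges. For a spanning tree $T$ of $G$ and an edge $\ell$ of $G$, $P^T_\ell$ denotes the unique path in $T$ joining the two ends of $\ell$, viewed as a set of edges of $T$. If $G$ has a single vertex, then $T$ is empty and the integral over $[0,1]^T$ is simply the value of the integrand; empty products equal $1$. *)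

theory Defs
  imports
    "HOL-Analysis.Analysis"
    "HOL-Combinatorics.Multiset_Permutations"
    "HOL-Library.Uprod"
begin

(* Multiple edges are distinct edges with equal ends; a self-loop has ends Upair v v. *)
record ('v, 'e) multigraph =
  verts :: "'v set"
  edges :: "'e set"
  ends :: "'e \<Rightarrow> 'v uprod"

definition finite_multigraph :: "('v, 'e) multigraph \<Rightarrow> bool" where
  "finite_multigraph G \<longleftrightarrow>
     finite (verts G) \<and> finite (edges G) \<and> (\<forall>e\<in>edges G. set_uprod (ends G e) \<subseteq> verts G)"

definition is_loop :: "('v, 'e) multigraph \<Rightarrow> 'e \<Rightarrow> bool" where
  "is_loop G e \<longleftrightarrow> (\<exists>v. ends G e = Upair v v)"

(* The path visits the vertices vs in order, the i-th edge of es joining the i-th and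
   (i+1)-st of them.  The trivial path has vs = [v] and es = []. *)
definition is_path :: "('v, 'e) multigraph \<Rightarrow> 'v \<Rightarrow> 'v list \<Rightarrow> 'e list \<Rightarrow> 'v \<Rightarrow> bool" where
  "is_path G u vs es v \<longleftrightarrow>
     length vs = Suc (length es) \<and> hd vs = u \<and> last vs = v \<and> distinct vs \<and>
     set vs \<subseteq> verts G \<and> set es \<subseteq> edges G \<and>
     (\<forall>i<length es. ends G (es ! i) = Upair (vs ! i) (vs ! Suc i))"

(* Length one gives a self-loop, length two a pair of parallel edges. *)
definition is_cycle :: "('v, 'e) multigraph \<Rightarrow> 'v list \<Rightarrow> 'e list \<Rightarrow> bool" where
  "is_cycle G vs es \<longleftrightarrow>
     es \<noteq> [] \<and> length vs = length es \<and> distinct vs \<and> distinct es \<and>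
     set vs \<subseteq> verts G \<and> set es \<subseteq> edges G \<and>
     (\<forall>i<length es. ends G (es ! i) = Upair (vs ! i) (vs ! (Suc i mod length es)))"

definition has_cycle :: "('v, 'e) multigraph \<Rightarrow> bool" where
  "has_cycle G \<longleftrightarrow> (\<exists>vs es. is_cycle G vs es)"

definition connected_multigraph :: "('v, 'e) multigraph \<Rightarrow> bool" where
  "connected_multigraph G \<longleftrightarrow>
     verts G \<noteq> {} \<and> (\<forall>u\<in>verts G. \<forall>v\<in>verts G. \<exists>vs es. is_path G u vs es v)"

definition spanning_subgraph :: "('v, 'e) multigraph \<Rightarrow> 'e set \<Rightarrow> ('v, 'e) multigraph" where
  "spanning_subgraph G F = G\<lparr>edges := F\<rparr>"

definition spanning_tree :: "('v, 'e) multigraph \<Rightarrow> 'e set \<Rightarrow> bool" where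
  "spanning_tree G T \<longleftrightarrow>
     T \<subseteq> edges G \<and> connected_multigraph (spanning_subgraph G T) \<and>
     \<not> has_cycle (spanning_subgraph G T)"

(* One step of Kruskal's algorithm, F being the set of edges picked so far. *)
definition kruskal_step :: "('v, 'e) multigraph \<Rightarrow> 'e \<Rightarrow> 'e set \<Rightarrow> 'e set" where
  "kruskal_step G e F = (if has_cycle (spanning_subgraph G (insert e F)) then F else insert e F)"

definition leading_tree :: "('v, 'e) multigraph \<Rightarrow> 'e list \<Rightarrow> 'e set" where
  "leading_tree G \<sigma> = fold (kruskal_step G) \<sigma> {}"

(* A Hepp sector is represented by the duplicate-free list of all edges in increasing order. *)
definition hepp_sectors :: "('v, 'e) multigraph \<Rightarrow> 'e list set" where
  "hepp_sectors G = permutations_of_set (edges G)"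

definition num_sectors :: "('v, 'e) multigraph \<Rightarrow> 'e set \<Rightarrow> nat" where
  "num_sectors G T = card {\<sigma> \<in> hepp_sectors G. leading_tree G \<sigma> = T}"

definition tree_weight :: "('v, 'e) multigraph \<Rightarrow> 'e set \<Rightarrow> real" where
  "tree_weight G T = real (num_sectors G T) / fact (card (edges G))"

(* The edge set of the path in T joining the two ends of l; for a spanning tree T it is
   uniquely determined, the two orientations of the path having the same edges. *)
definition tree_path :: "('v, 'e) multigraph \<Rightarrow> 'e set \<Rightarrow> 'e \<Rightarrow> 'e set" where
  "tree_path G T l =
     (THE P. \<exists>u v vs es. ends G l = Upair u v \<and>
        is_path (spanning_subgraph G T) u vs es v \<and> P = set es)"

definition path_min :: "('v, 'e) multigraph \<Rightarrow> 'e set \<Rightarrow> ('e \<Rightarrow> real) \<Rightarrow> 'e \<Rightarrow> real" where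
  "path_min G T w l = (if is_loop G l then 1 else Min (w ` tree_path G T l))"

end

theory Submission
  imports Defs
begin

text \<open>Give the edges independent uniform parameters in \<open>[0,1]\<close> and order them by decreasing parameter:
  every Hepp sector has probability \<open>1 / |E|!\<close>. The leading tree is \<open>T\<close> exactly when every edge outside
  \<open>T\<close> has a smaller parameter than all edges of its tree path, and integrating out the parameters outside
  \<open>T\<close> turns the probability of this event into the integral of the product of path minima.\<close>

subsection \<open>Fundamental paths and leading trees\<close>

text \<open>Decreasing order is what makes minima appear: if T is the leading tree, an edge outside
  T is rejected because the edges picked before it contain its tree path, so its parameter has to
  lie below the minimum over that path. With the tree parameters fixed, these conditions concern
  distinct coordinates, one for each edge outside T. They cut out a box whose sides have the path
  minima as lengths; a self-loop has no condition and a side of length 1. Hence the product. The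
  graph part works with the reachability relation \<open>joined\<close> where it can, rather than
  with lists of vertices: in a tree, an edge lies on the path between two vertices exactly when
  deleting it separates them. This description does not depend on a chosen path, which settles the
  uniqueness behind the \<open>THE\<close> of \<open>tree_path\<close>.\<close>

definition joined :: "('v, 'e) multigraph \<Rightarrow> 'e set \<Rightarrow> ('v \<times> 'v) set" where
  "joined G F = {(x, y). \<exists>e\<in>F. ends G e = Upair x y}\<^sup>*"

lemma joined_refl [simp]: "(x, x) \<in> joined G F"
  by (simp add: joined_def)

lemma joined_trans: "(x, y) \<in> joined G F \<Longrightarrow> (y, z) \<in> joined G F \<Longrightarrow> (x, z) \<in> joined G F"
  unfolding joined_def by (rule rtrancl_trans)

lemma joined_edge: "e \<in> F \<Longrightarrow> ends G e = Upair x y \<Longrightarrow> (x, y) \<in> joined G F"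
  unfolding joined_def by (rule r_into_rtrancl) blast

lemma joined_mono: "F \<subseteq> F' \<Longrightarrow> joined G F \<subseteq> joined G F'"
  unfolding joined_def by (rule rtrancl_mono) blast

lemma joined_sym:
  assumes "(x, y) \<in> joined G F"
  shows "(y, x) \<in> joined G F"
proof -
  have "sym {(x, y). \<exists>e\<in>F. ends G e = Upair x y}"
    by (rule symI) (auto, metis Upair_inject)
  then show ?thesis
    using assms unfolding joined_def by (blast intro: symD[OF sym_rtrancl])
qed

text \<open>Keeping track of the edges used allows a path to be cut around one of its edges, as in
  \<open>acyclic_joined_iff\<close>.\<close>

lemma path_segment_joined:
  assumes "is_path (spanning_subgraph G F) u vs es v" "i \<le> j" "j \<le> length es"
  shows "(vs ! i, vs ! j) \<in> joined G ((!) es ` {i..<j})"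
  using assms(2,3)
proof (induction j rule: dec_induct)
  case (step j)
  have "(vs ! i, vs ! j) \<in> joined G ((!) es ` {i..<Suc j})"
    using step joined_mono[of "(!) es ` {i..<j}" "(!) es ` {i..<Suc j}"] by fastforce
  moreover have "ends G (es ! j) = Upair (vs ! j) (vs ! Suc j)"
    using assms(1) step.prems by (simp add: is_path_def spanning_subgraph_def)
  then have "(vs ! j, vs ! Suc j) \<in> joined G ((!) es ` {i..<Suc j})"
    using step.hyps by (intro joined_edge) auto
  ultimately show ?case
    by (rule joined_trans)
qed simp

lemma is_path_first_last:
  assumes "is_path G u vs es v"
  shows "vs ! 0 = u" "vs ! length es = v"
proof -
  have "vs \<noteq> []" "length vs = Suc (length es)" "hd vs = u" "last vs = v"
    using assms by (auto simp: is_path_def)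
  then show "vs ! 0 = u" "vs ! length es = v"
    by (simp_all add: hd_conv_nth last_conv_nth)
qed

lemma path_joined:
  assumes "is_path (spanning_subgraph G F) u vs es v"
  shows "(u, v) \<in> joined G (set es)"
proof -
  have "(!) es ` {0..<length es} = set es"
    by (auto simp: set_conv_nth)
  then show ?thesis
    using path_segment_joined[OF assms, of 0 "length es"] is_path_first_last[OF assms] by simp
qed

text \<open>A repeated edge would have the same ends at two positions, so the vertex before its
  first use would recur later on the path.\<close>

lemma is_path_distinct_edges:
  assumes "is_path G u vs es v"
  shows "distinct es"
proof -
  have "es ! i \<noteq> es ! j" if "i < j" "j < length es" for i j
  proof
    assume "es ! i = es ! j"
    then have "Upair (vs ! i) (vs ! Suc i) = Upair (vs ! j) (vs ! Suc j)"
      using assms that unfolding is_path_def by (metis order.strict_trans)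
    moreover have "distinct vs" "length vs = Suc (length es)"
      using assms by (auto simp: is_path_def)
    ultimately show False
      using that by (auto simp: nth_eq_iff_index_eq)
  qed
  then show ?thesis
    unfolding distinct_conv_nth by (metis linorder_neqE_nat)
qed

text \<open>Where the new vertex already lies on the path, the path is cut there instead of extended.\<close>

lemma joined_imp_path:
  assumes "finite_multigraph G" "F \<subseteq> edges G" "u \<in> verts G" "(u, v) \<in> joined G F"
  shows "\<exists>vs es. is_path (spanning_subgraph G F) u vs es v"
  using assms(4) unfolding joined_def
proof (induction rule: rtrancl_induct)
  case base
  have "is_path (spanning_subgraph G F) u [u] [] u"
    using assms(3) by (simp add: is_path_def spanning_subgraph_def)
  then show ?case by blast
next
  case (step y z)
  then obtain vs es where p: "is_path (spanning_subgraph G F) u vs es y"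
    by blast
  obtain e where e: "e \<in> F" "ends G e = Upair y z"
    using step.hyps by blast
  show ?case
  proof (cases "z \<in> set vs")
    case True
    then obtain k where k: "k < length vs" "vs ! k = z"
      by (auto simp: in_set_conv_nth)
    have "is_path (spanning_subgraph G F) u (take (Suc k) vs) (take k es) z"
    proof -
      have "last (take (Suc k) vs) = z"
        using k by (simp add: take_Suc_conv_app_nth)
      moreover have "hd (take (Suc k) vs) = hd vs"
        by (cases vs) simp_all
      moreover have "set (take k es) \<subseteq> set es" "set (take (Suc k) vs) \<subseteq> set vs"
        by (rule set_take_subset)+
      ultimately show ?thesis
        using p k by (auto simp: is_path_def)
    qed
    then show ?thesis by blast
  next
    case False
    have "set_uprod (ends G e) \<subseteq> verts G"
      using assms(1,2) e(1) by (auto simp: finite_multigraph_def)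
    then have z: "z \<in> verts G"
      using e by simp
    have "is_path (spanning_subgraph G F) u (vs @ [z]) (es @ [e]) z"
    proof -
      have "vs \<noteq> []" "length vs = Suc (length es)"
        using p by (auto simp: is_path_def)
      moreover have "vs ! length es = y"
        using is_path_first_last[OF p] by simp
      ultimately show ?thesis
        using p False e z
        by (simp add: is_path_def spanning_subgraph_def nth_append less_Suc_eq)
    qed
    then show ?thesis by blast
  qed
qed

text \<open>A path from x to y avoiding e is closed up by e. If e is a self-loop, the path is
  trivial and the cycle has length one.\<close>

lemma has_cycleI:
  assumes G: "finite_multigraph G" "F \<subseteq> edges G"
    and e: "e \<in> F" "ends G e = Upair x y" "(x, y) \<in> joined G (F - {e})"
  shows "has_cycle (spanning_subgraph G F)"
proof -
  have "set_uprod (ends G e) \<subseteq> verts G"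
    using G e(1) by (auto simp: finite_multigraph_def)
  then have "x \<in> verts G"
    using e by simp
  then obtain vs es where p: "is_path (spanning_subgraph G (F - {e})) x vs es y"
    using joined_imp_path[OF G(1) _ _ e(3)] G(2) by blast
  have [simp]: "vs ! 0 = x" "vs ! length es = y"
    using is_path_first_last[OF p] by auto
  \<comment> \<open>The successor index wraps to 0 at the closing edge, so e has to be read from the
    last vertex y to the first vertex x.\<close>
  have "ends G e = Upair y x"
    using e(2) by simp
  then have "ends G ((es @ [e]) ! i) = Upair (vs ! i) (vs ! (Suc i mod length (es @ [e])))"
    if "i < length (es @ [e])" for i
    using that p by (cases "i = length es") (auto simp: is_path_def spanning_subgraph_def nth_append)
  then have "is_cycle (spanning_subgraph G F) vs (es @ [e])"
    using p e(1) is_path_distinct_edges[OF p]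
    by (auto simp: is_cycle_def is_path_def spanning_subgraph_def)
  then show ?thesis
    unfolding has_cycle_def by blast
qed

text \<open>Converse of \<open>has_cycleI\<close>: going around the cycle from the far end of e, the
  other edges lead back to its near end.\<close>

lemma cycle_joined:
  assumes c: "is_cycle (spanning_subgraph G F) vs es" and e: "e \<in> set es" "ends G e = Upair x y"
  shows "(x, y) \<in> joined G (F - {e})"
proof -
  define n where "n = length es"
  have n: "n > 0" "distinct es" "set es \<subseteq> F"
    and es: "\<And>i. i < n \<Longrightarrow> ends G (es ! i) = Upair (vs ! i) (vs ! (Suc i mod n))"
    using c by (auto simp: is_cycle_def n_def spanning_subgraph_def)
  obtain i where i: "i < n" "es ! i = e"
    using e(1) by (auto simp: in_set_conv_nth n_def)
  \<comment> \<open>Here k counts the edges walked after e; k = n - 1 brings the walk back to index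
    i.\<close>
  have round: "(vs ! (Suc i mod n), vs ! ((Suc i + k) mod n)) \<in> joined G (F - {e})" if "k < n" for k
    using that
  proof (induction k)
    case (Suc k)
    define j where "j = (Suc i + k) mod n"
    have j: "j < n" "Suc j mod n = (Suc i + Suc k) mod n"
      using n by (auto simp: j_def mod_Suc_eq)
    \<comment> \<open>The walk would use e again only after a full turn, when n divides
      \<open>Suc k\<close>, but \<open>Suc k < n\<close>.\<close>
    have "j \<noteq> i"
    proof
      assume "j = i"
      then have "(i + Suc k) mod n = (i + 0) mod n"
        using i by (simp add: j_def)
      then have "n dvd Suc k"
        by (metis add_cancel_left_right mod_eq_dvd_iff_nat le_add1 diff_add_inverse add.right_neutral)
      then show False
        using Suc.prems by (auto dest: dvd_imp_le)
    qed
    then have "es ! j \<in> F - {e}"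
      using n i j by (auto simp: n_def nth_eq_iff_index_eq)
    from joined_edge[OF this es[OF j(1)]] Suc show ?case
      unfolding j(2) using joined_trans j_def by (metis Suc_lessD)
  qed simp
  have "(Suc i + (n - 1)) mod n = i"
    using n i by simp
  then have "(vs ! (Suc i mod n), vs ! i) \<in> joined G (F - {e})"
    using round[of "n - 1"] n by simp
  moreover have "Upair x y = Upair (vs ! i) (vs ! (Suc i mod n))"
    using e es i by metis
  ultimately show ?thesis
    by (auto dest: joined_sym)
qed

text \<open>Suppose that e lies on the path and that u and v are also joined without e. The parts of
  the path before and after e avoid e, so together with this detour they join the ends of e, and e
  closes a cycle.\<close>

lemma acyclic_joined_iff:
  assumes G: "finite_multigraph G" "F \<subseteq> edges G" "\<not> has_cycle (spanning_subgraph G F)"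
    and p: "is_path (spanning_subgraph G F) u vs es v" and e: "e \<in> F"
  shows "(u, v) \<in> joined G (F - {e}) \<longleftrightarrow> e \<notin> set es"
proof
  assume "e \<notin> set es"
  moreover have "set es \<subseteq> F"
    using p by (simp add: is_path_def spanning_subgraph_def)
  ultimately have "joined G (set es) \<subseteq> joined G (F - {e})"
    by (intro joined_mono) blast
  then show "(u, v) \<in> joined G (F - {e})"
    using path_joined[OF p] by blast
next
  assume uv: "(u, v) \<in> joined G (F - {e})"
  show "e \<notin> set es"
  proof
    assume "e \<in> set es"
    then obtain i where i: "i < length es" "es ! i = e"
      by (auto simp: in_set_conv_nth)
    have es: "set es \<subseteq> F" "distinct es"
      using p is_path_distinct_edges[OF p] by (auto simp: is_path_def spanning_subgraph_def)
    have "(!) es ` {0..<i} \<subseteq> F - {e}" "(!) es ` {Suc i..<length es} \<subseteq> F - {e}"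
      using es i by (auto simp: nth_eq_iff_index_eq)
    then have "(u, vs ! i) \<in> joined G (F - {e})" "(vs ! Suc i, v) \<in> joined G (F - {e})"
      using path_segment_joined[OF p, of 0 i] path_segment_joined[OF p, of "Suc i" "length es"]
        is_path_first_last[OF p] i joined_mono
      by (metis Suc_leI le_eq_less_or_eq subsetD zero_le)+
    then have "(vs ! i, vs ! Suc i) \<in> joined G (F - {e})"
      using uv joined_sym joined_trans by metis
    moreover have "ends G e = Upair (vs ! i) (vs ! Suc i)"
      using p i by (auto simp: is_path_def spanning_subgraph_def)
    ultimately show False
      using has_cycleI[OF G(1,2) e] G(3) by blast
  qed
qed

text \<open>By \<open>acyclic_joined_iff\<close> these are the edges of the tree path; a self-loop gets the empty set.\<close>

definition separating_edges :: "('v, 'e) multigraph \<Rightarrow> 'e set \<Rightarrow> 'e \<Rightarrow> 'e set" where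
  "separating_edges G T l = {e \<in> T. \<exists>u v. ends G l = Upair u v \<and> (u, v) \<notin> joined G (T - {e})}"

lemma separating_edges_eq:
  assumes "ends G l = Upair u v"
  shows "separating_edges G T l = {e \<in> T. (u, v) \<notin> joined G (T - {e})}"
  using assms by (auto simp: separating_edges_def dest: joined_sym)

lemma separating_edges_loop: "is_loop G l \<Longrightarrow> separating_edges G T l = {}"
  unfolding is_loop_def using separating_edges_eq[of G l] by fastforce

lemma separating_edges_path:
  assumes "finite_multigraph G" "T \<subseteq> edges G" "\<not> has_cycle (spanning_subgraph G T)"
    and "ends G l = Upair u v" "is_path (spanning_subgraph G T) u vs es v"
  shows "separating_edges G T l = set es"
proof -
  have "set es \<subseteq> T"
    using assms(5) by (simp add: is_path_def spanning_subgraph_def)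
  then show ?thesis
    using acyclic_joined_iff[OF assms(1,2,3,5)] by (auto simp: separating_edges_eq[OF assms(4)])
qed

lemma tree_path_exists:
  assumes "finite_multigraph G" "spanning_tree G T" "l \<in> edges G"
  obtains u v vs es where "ends G l = Upair u v" "is_path (spanning_subgraph G T) u vs es v"
    "separating_edges G T l = set es"
proof -
  obtain u v where uv: "ends G l = Upair u v"
    by (metis uprod_exhaust)
  have "set_uprod (ends G l) \<subseteq> verts G"
    using assms by (auto simp: finite_multigraph_def)
  then have "u \<in> verts G" "v \<in> verts G"
    using uv by auto
  then obtain vs es where p: "is_path (spanning_subgraph G T) u vs es v"
    using assms(2) by (fastforce simp: spanning_tree_def connected_multigraph_def spanning_subgraph_def)
  with that uv assms separating_edges_path[OF assms(1) _ _ uv p] show thesis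
    by (auto simp: spanning_tree_def)
qed

text \<open>Connectedness supplies a path, and every path between the ends of l, in either
  orientation, has the separating edges as its edge set; so the \<open>THE\<close> denotes.\<close>

lemma tree_path_eq_separating_edges:
  assumes "finite_multigraph G" "spanning_tree G T" "l \<in> edges G"
  shows "tree_path G T l = separating_edges G T l"
  unfolding tree_path_def
proof (rule the_equality)
  show "\<exists>u v vs es. ends G l = Upair u v \<and> is_path (spanning_subgraph G T) u vs es v
      \<and> separating_edges G T l = set es"
    using tree_path_exists[OF assms] by metis
next
  fix P
  assume "\<exists>u v vs es. ends G l = Upair u v \<and> is_path (spanning_subgraph G T) u vs es v \<and> P = set es"
  then show "P = separating_edges G T l"
    using separating_edges_path[OF assms(1)] assms(2) unfolding spanning_tree_def by metis
qed

text \<open>Makes the case distinction \<open>P l = {}\<close> of the volume computation agree with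
  the test \<open>is_loop\<close> in \<open>path_min\<close>, and keeps \<open>Min\<close> away from
  the empty set.\<close>

lemma separating_edges_nonempty:
  assumes "finite_multigraph G" "spanning_tree G T" "l \<in> edges G" "\<not> is_loop G l"
  shows "separating_edges G T l \<noteq> {}"
proof -
  obtain u v vs es where *: "ends G l = Upair u v" "is_path (spanning_subgraph G T) u vs es v"
    "separating_edges G T l = set es"
    by (rule tree_path_exists[OF assms(1-3)])
  have "es \<noteq> []"
  proof
    assume "es = []"
    then have "u = v"
      using is_path_first_last[OF *(2)] by simp
    then show False
      using *(1) assms(4) by (auto simp: is_loop_def)
  qed
  with * show ?thesis by simp
qed

text \<open>For l outside T: once its separating edges have been picked, l closes a cycle.\<close>

lemma joined_separating_edges:
  assumes "finite_multigraph G" "spanning_tree G T" "l \<in> edges G" "ends G l = Upair x y"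
  shows "(x, y) \<in> joined G (separating_edges G T l)"
proof -
  obtain u v vs es where *: "ends G l = Upair u v" "is_path (spanning_subgraph G T) u vs es v"
    "separating_edges G T l = set es"
    by (rule tree_path_exists[OF assms(1-3)])
  then show ?thesis
    using path_joined[OF *(2)] assms(4) by (auto dest: joined_sym)
qed

section \<open>Kruskal's algorithm\<close>

lemma has_cycle_mono:
  assumes "has_cycle (spanning_subgraph G F)" "F \<subseteq> F'"
  shows "has_cycle (spanning_subgraph G F')"
proof -
  obtain vs es where "is_cycle (spanning_subgraph G F) vs es"
    using assms(1) unfolding has_cycle_def by blast
  then have "is_cycle (spanning_subgraph G F') vs es"
    using assms(2) by (auto simp: is_cycle_def spanning_subgraph_def)
  then show ?thesis
    unfolding has_cycle_def by blast
qed

text \<open>The cycle has to pass through l, and the rest of it joins the ends of l inside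
  F.\<close>

lemma has_cycle_insertD:
  assumes "has_cycle (spanning_subgraph G (insert l F))" "\<not> has_cycle (spanning_subgraph G F)"
    and "l \<notin> F" "ends G l = Upair u v"
  shows "(u, v) \<in> joined G F"
proof -
  obtain vs es where c: "is_cycle (spanning_subgraph G (insert l F)) vs es"
    using assms(1) by (auto simp: has_cycle_def)
  have "l \<in> set es"
  proof (rule ccontr)
    assume "l \<notin> set es"
    then have "is_cycle (spanning_subgraph G F) vs es"
      using c by (auto simp: is_cycle_def spanning_subgraph_def)
    then show False
      using assms(2) unfolding has_cycle_def by blast
  qed
  then show ?thesis
    using cycle_joined[OF c _ assms(4)] assms(3) by simp
qed

lemma leading_tree_snoc:
  "leading_tree G (\<sigma> @ [l]) = kruskal_step G l (leading_tree G \<sigma>)"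
  by (simp add: leading_tree_def)

lemma leading_tree_subset: "leading_tree G \<sigma> \<subseteq> set \<sigma>"
proof (induction \<sigma> rule: rev_induct)
  case Nil
  then show ?case by (simp add: leading_tree_def)
next
  case (snoc l \<sigma>)
  then show ?case by (auto simp: leading_tree_snoc kruskal_step_def)
qed

text \<open>Picked edges are never dropped, so decisions made on a prefix of a sector can be read
  off the final tree.\<close>

lemma leading_tree_append: "leading_tree G \<sigma> \<subseteq> leading_tree G (\<sigma> @ \<tau>)"
proof (induction \<tau> rule: rev_induct)
  case (snoc l \<tau>)
  then show ?case
    unfolding append_assoc[symmetric] leading_tree_snoc kruskal_step_def by auto
qed simp

text \<open>Forwards, the tree edges picked before a rejected l join its ends, so they include all
  its separating edges, which therefore have larger parameters. Backwards, the inequalities put the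
  whole tree path before l, so l is rejected, while tree edges are accepted because T is
  acyclic.\<close>

lemma leading_tree_eq_iff:
  fixes w :: "'e \<Rightarrow> real"
  assumes G: "finite_multigraph G" and T: "spanning_tree G T"
    and \<sigma>: "set \<sigma> = edges G" "sorted_wrt (\<lambda>a b. w b < w a) \<sigma>"
  shows "leading_tree G \<sigma> = T \<longleftrightarrow> (\<forall>l\<in>edges G - T. \<forall>l'\<in>separating_edges G T l. w l < w l')"
proof
  assume eq: "leading_tree G \<sigma> = T"
  show "\<forall>l\<in>edges G - T. \<forall>l'\<in>separating_edges G T l. w l < w l'"
  proof (intro ballI)
    fix l l' assume l: "l \<in> edges G - T" and l': "l' \<in> separating_edges G T l"
    obtain p q where pq: "\<sigma> = p @ l # q"
      using l \<sigma>(1) by (metis DiffD1 split_list)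
    define F where "F = leading_tree G p"
    have F: "F \<subseteq> T" "F \<subseteq> set p"
      using leading_tree_append[of G p "l # q"] eq pq leading_tree_subset[of G p] by (auto simp: F_def)
    have "l \<notin> leading_tree G (p @ [l])"
      using leading_tree_append[of G "p @ [l]" q] eq pq l by auto
    then have "has_cycle (spanning_subgraph G (insert l F))"
      by (auto simp: leading_tree_snoc kruskal_step_def F_def split: if_splits)
    moreover have "\<not> has_cycle (spanning_subgraph G F)"
      using F(1) T has_cycle_mono by (auto simp: spanning_tree_def)
    moreover obtain u v where uv: "ends G l = Upair u v"
      by (metis uprod_exhaust)
    ultimately have "(u, v) \<in> joined G F"
      using has_cycle_insertD F(1) l by (metis Diff_iff subsetD)
    moreover have "l' \<in> T" "(u, v) \<notin> joined G (T - {l'})"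
      using l' by (auto simp: separating_edges_eq[OF uv])
    \<comment> \<open>Otherwise F would lie in \<open>T - {l'}\<close>, whose edges do not join the
      ends of l.\<close>
    ultimately have "l' \<in> F"
      using joined_mono[of F "T - {l'}" G] F(1) by blast
    then show "w l < w l'"
      using F(2) \<sigma>(2) pq by (auto simp: sorted_wrt_append)
  qed
next
  assume *: "\<forall>l\<in>edges G - T. \<forall>l'\<in>separating_edges G T l. w l < w l'"
  have T': "T \<subseteq> edges G" "\<not> has_cycle (spanning_subgraph G T)"
    using T by (auto simp: spanning_tree_def)
  \<comment> \<open>Invariant on prefixes; keeping the remainder q in the claim gives access to the
    ordering of the whole of \<sigma>.\<close>
  have "leading_tree G p = T \<inter> set p" if "\<sigma> = p @ q" for p q
    using that
  proof (induction p arbitrary: q rule: rev_induct)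
    case Nil
    then show ?case by (simp add: leading_tree_def)
  next
    case (snoc l p)
    then have IH: "leading_tree G p = T \<inter> set p"
      by simp
    show ?case
    proof (cases "l \<in> T")
      case True
      then have "\<not> has_cycle (spanning_subgraph G (insert l (T \<inter> set p)))"
        using T'(2) has_cycle_mono[of G "insert l (T \<inter> set p)" T] by blast
      then show ?thesis
        using True IH by (simp add: leading_tree_snoc kruskal_step_def)
    next
      case False
      have l: "l \<in> edges G"
        using \<sigma>(1) snoc.prems by auto
      obtain u v where uv: "ends G l = Upair u v"
        by (metis uprod_exhaust)
      have "separating_edges G T l \<subseteq> T \<inter> set p"
      proof
        fix l' assume l': "l' \<in> separating_edges G T l"
        then have "l' \<in> T"
          by (simp add: separating_edges_def)
        moreover have "w l < w l'"
          using * l' l False by blast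
        ultimately show "l' \<in> T \<inter> set p"
          using \<sigma> snoc.prems T'(1) by (fastforce simp: sorted_wrt_append)
      qed
      then have "(u, v) \<in> joined G (T \<inter> set p)"
        using joined_separating_edges[OF G T l uv] joined_mono by blast
      then have "has_cycle (spanning_subgraph G (insert l (T \<inter> set p)))"
        using False l T'(1) uv by (intro has_cycleI[OF G, of _ l]) auto
      then show ?thesis
        using False IH by (simp add: leading_tree_snoc kruskal_step_def)
    qed
  qed
  from this[of \<sigma> "[]"] show "leading_tree G \<sigma> = T"
    using T'(1) \<sigma>(1) by auto
qed

subsection \<open>Volumes in the cube\<close>

interpretation lborel_product: product_sigma_finite "\<lambda>_. lborel :: real measure"
  by standard

text \<open>The symmetry that makes all sectors equally likely. It suffices to check boxes, where
  reindexing merely permutes the factors of the volume.\<close>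

lemma distr_PiM_lborel_reindex:
  fixes I :: "'i set"
  assumes "finite I" "bij_betw \<pi> I I"
  shows "distr (\<Pi>\<^sub>M i\<in>I. lborel) (\<Pi>\<^sub>M i\<in>I. lborel) (\<lambda>w. \<lambda>i\<in>I. w (\<pi> i)) = (\<Pi>\<^sub>M i\<in>I. lborel :: real measure)"
proof (rule lborel_product.PiM_eqI)
  fix A :: "'i \<Rightarrow> real set" assume A: "\<And>i. i \<in> I \<Longrightarrow> A i \<in> sets lborel"
  let ?M = "\<Pi>\<^sub>M i\<in>I. lborel :: real measure" and ?f = "\<lambda>w::'i \<Rightarrow> real. \<lambda>i\<in>I. w (\<pi> i)"
  let ?B = "\<lambda>j. A (inv_into I \<pi> j)"
  have \<pi>: "\<pi> i \<in> I" "inv_into I \<pi> i \<in> I" "\<pi> (inv_into I \<pi> i) = i" "inv_into I \<pi> (\<pi> i) = i"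
    if "i \<in> I" for i
    using that assms(2) by (auto simp: bij_betw_def inv_into_into f_inv_into_f)
  have f: "?f \<in> measurable ?M ?M"
    using \<pi>(1) by (intro measurable_restrict measurable_component_singleton)
  have "?f -` Pi\<^sub>E I A \<inter> space ?M = Pi\<^sub>E I ?B"
  proof (intro set_eqI iffI)
    fix w assume "w \<in> ?f -` Pi\<^sub>E I A \<inter> space ?M"
    then have w: "w \<in> extensional I" "\<And>i. i \<in> I \<Longrightarrow> w (\<pi> i) \<in> A i"
      by (auto simp: space_PiM PiE_def Pi_def)
    have "w j \<in> ?B j" if "j \<in> I" for j
      using w(2)[OF \<pi>(2)[OF that]] \<pi>(3)[OF that] by simp
    then show "w \<in> Pi\<^sub>E I ?B"
      using w(1) by (simp add: PiE_iff)
  next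
    fix w assume w: "w \<in> Pi\<^sub>E I ?B"
    have "w (\<pi> i) \<in> A i" if "i \<in> I" for i
      using PiE_mem[OF w \<pi>(1)[OF that]] \<pi>(4)[OF that] by simp
    then show "w \<in> ?f -` Pi\<^sub>E I A \<inter> space ?M"
      using w by (auto simp: space_PiM PiE_def)
  qed
  then have "emeasure (distr ?M ?M ?f) (Pi\<^sub>E I A) = emeasure ?M (Pi\<^sub>E I ?B)"
    using f A assms(1) by (subst emeasure_distr) (auto intro!: sets_PiM_I_finite)
  also have "\<dots> = (\<Prod>j\<in>I. emeasure lborel (?B j))"
    using assms(1) A \<pi>(2) by (intro lborel_product.emeasure_PiM) auto
  also have "\<dots> = (\<Prod>i\<in>I. emeasure lborel (?B (\<pi> i)))"
    using assms(2) by (rule prod.reindex_bij_betw[symmetric])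
  also have "\<dots> = (\<Prod>i\<in>I. emeasure lborel (A i))"
    using \<pi> by (intro prod.cong) auto
  finally show "emeasure (distr ?M ?M ?f) (Pi\<^sub>E I A) = (\<Prod>i\<in>I. emeasure lborel (A i))" .
qed (use assms in auto)

text \<open>Integrate coordinate i out first: with the others fixed, a tie confines it to the single
  point \<open>x j\<close>.\<close>

lemma AE_PiM_lborel_neq:
  assumes "finite I" "i \<in> I" "j \<in> I" "i \<noteq> j"
  shows "AE w in (\<Pi>\<^sub>M i\<in>I. lborel :: real measure). w i \<noteq> w j"
proof -
  define J where "J = I - {i}"
  have J: "finite J" "i \<notin> J" "j \<in> J" "I = insert i J"
    using assms by (auto simp: J_def)
  let ?M = "\<Pi>\<^sub>M i\<in>I. lborel :: real measure"
  have meas [measurable]: "{w \<in> space ?M. w i = w j} \<in> sets ?M"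
    using assms(2,3) by measurable
  have "emeasure ?M {w \<in> space ?M. w i = w j} = (\<integral>\<^sup>+ w. indicator {w \<in> space ?M. w i = w j} w \<partial>?M)"
    by (rule nn_integral_indicator[symmetric]) (rule meas)
  also have "\<dots> = (\<integral>\<^sup>+ x. \<integral>\<^sup>+ y. indicator {w \<in> space ?M. w i = w j} (x(i := y)) \<partial>lborel \<partial>(\<Pi>\<^sub>M i\<in>J. lborel))"
    unfolding J(4) using J(1,2)
    by (intro lborel_product.product_nn_integral_insert) (use meas J(4) in auto)
  also have "\<dots> = (\<integral>\<^sup>+ x. \<integral>\<^sup>+ y. indicator {x j} y \<partial>lborel \<partial>(\<Pi>\<^sub>M i\<in>J. lborel :: real measure))"
    using assms(4) by (intro nn_integral_cong) (auto simp: indicator_def space_PiM J(4) PiE_def extensional_def)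
  also have "\<dots> = 0"
    by simp
  finally show ?thesis
    using meas by (intro AE_I[where N = "{w \<in> space ?M. w i = w j}"]) auto
qed

lemma AE_PiM_lborel_inj_on:
  assumes "finite I"
  shows "AE w in (\<Pi>\<^sub>M i\<in>I. lborel :: real measure). inj_on w I"
proof -
  have "AE w in (\<Pi>\<^sub>M i\<in>I. lborel :: real measure). \<forall>i\<in>I. \<forall>j\<in>I. i \<noteq> j \<longrightarrow> w i \<noteq> w j"
  proof (intro AE_finite_allI assms)
    fix i j assume "i \<in> I" "j \<in> I"
    then show "AE w in (\<Pi>\<^sub>M i\<in>I. lborel :: real measure). i \<noteq> j \<longrightarrow> w i \<noteq> w j"
      using AE_PiM_lborel_neq[OF assms] by (cases "i = j") auto
  qed
  then show ?thesis
    by eventually_elim (auto simp: inj_on_def)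
qed

section \<open>Regions of the cube belonging to the sectors\<close>

definition cube :: "'i set \<Rightarrow> ('i \<Rightarrow> real) set" where
  "cube I = (\<Pi>\<^sub>E i\<in>I. {0..1})"

lemma cube_sets [measurable]: "finite I \<Longrightarrow> cube I \<in> sets (\<Pi>\<^sub>M i\<in>I. lborel)"
  unfolding cube_def by (rule sets_PiM_I_finite) auto

lemma cube_subset_space: "cube I \<subseteq> space (\<Pi>\<^sub>M i\<in>I. lborel)"
  by (auto simp: cube_def space_PiM PiE_def)

lemma emeasure_cube: "finite I \<Longrightarrow> emeasure (\<Pi>\<^sub>M i\<in>I. lborel) (cube I) = 1"
  unfolding cube_def by (subst lborel_product.emeasure_PiM) auto

text \<open>The strict order keeps regions of different sectors disjoint; points with ties lie in
  none of them.\<close>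

definition sector_region :: "'i list \<Rightarrow> ('i \<Rightarrow> real) set" where
  "sector_region \<sigma> = {w \<in> cube (set \<sigma>). sorted_wrt (\<lambda>a b. w b < w a) \<sigma>}"

lemma sector_region_sets [measurable]: "sector_region \<sigma> \<in> sets (\<Pi>\<^sub>M i\<in>set \<sigma>. lborel)"
proof -
  let ?M = "\<Pi>\<^sub>M i\<in>set \<sigma>. lborel :: real measure"
  \<comment> \<open>The guards hold for indices within range. They make the set measurable for all
    naturals i and j, even where \<open>\<sigma> ! i\<close> may fall outside the index set.\<close>
  have "{w \<in> space ?M. \<sigma> ! j \<in> set \<sigma> \<longrightarrow> \<sigma> ! i \<in> set \<sigma> \<longrightarrow> w (\<sigma> ! j) < w (\<sigma> ! i)} \<in> sets ?M" for i j
    by (cases "\<sigma> ! j \<in> set \<sigma> \<and> \<sigma> ! i \<in> set \<sigma>") (simp_all, measurable)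
  then have "{w \<in> space ?M. \<forall>i<length \<sigma>. \<forall>j<length \<sigma>. i < j \<longrightarrow>
      (\<sigma> ! j \<in> set \<sigma> \<longrightarrow> \<sigma> ! i \<in> set \<sigma> \<longrightarrow> w (\<sigma> ! j) < w (\<sigma> ! i))} \<in> sets ?M"
    by measurable
  moreover have "sector_region \<sigma> = cube (set \<sigma>) \<inter> {w \<in> space ?M. \<forall>i<length \<sigma>. \<forall>j<length \<sigma>. i < j \<longrightarrow>
      (\<sigma> ! j \<in> set \<sigma> \<longrightarrow> \<sigma> ! i \<in> set \<sigma> \<longrightarrow> w (\<sigma> ! j) < w (\<sigma> ! i))}"
    using cube_subset_space by (fastforce simp: sector_region_def sorted_wrt_iff_nth_less)
  ultimately show ?thesis
    by auto
qed

text \<open>Reindexing by the bijection that sends each entry of \<sigma> to the entry of \<tau> at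
  the same position pulls one region back to the other.\<close>

lemma emeasure_sector_region_eq:
  assumes "distinct \<sigma>" "distinct \<tau>" "set \<sigma> = set \<tau>"
  shows "emeasure (\<Pi>\<^sub>M i\<in>set \<sigma>. lborel) (sector_region \<sigma>) = emeasure (\<Pi>\<^sub>M i\<in>set \<sigma>. lborel) (sector_region \<tau>)"
proof -
  let ?I = "set \<sigma>"
  let ?M = "\<Pi>\<^sub>M i\<in>?I. lborel :: real measure"
  define n where "n = length \<sigma>"
  have n: "length \<tau> = n"
    using assms by (metis distinct_card n_def)
  define \<pi> where "\<pi> = (!) \<tau> \<circ> inv_into {..<n} ((!) \<sigma>)"
  have b: "bij_betw ((!) \<sigma>) {..<n} ?I" "bij_betw ((!) \<tau>) {..<n} ?I"
    using assms n by (auto intro!: bij_betw_nth simp: n_def)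
  have \<pi>: "bij_betw \<pi> ?I ?I"
    unfolding \<pi>_def by (intro bij_betw_trans[OF bij_betw_inv_into b(2)] b(1))
  have nth: "\<pi> (\<sigma> ! i) = \<tau> ! i" if "i < n" for i
    using that b(1) by (simp add: \<pi>_def bij_betw_def)
  let ?f = "\<lambda>w::'a \<Rightarrow> real. \<lambda>i\<in>?I. w (\<pi> i)"
  have \<pi>I: "\<pi> i \<in> ?I" if "i \<in> ?I" for i
    using that \<pi> by (auto simp: bij_betw_def)
  have f: "?f \<in> measurable ?M ?M"
    using \<pi>I by (intro measurable_restrict measurable_component_singleton)
  have "?f -` sector_region \<sigma> \<inter> space ?M = sector_region \<tau>"
  proof (intro set_eqI)
    fix w :: "'a \<Rightarrow> real"
    have "?f w \<in> cube ?I \<longleftrightarrow> (\<forall>i\<in>\<pi> ` ?I. w i \<in> {0..1})"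
      by (simp add: cube_def PiE_iff)
    also have "\<pi> ` ?I = ?I"
      using \<pi> by (simp add: bij_betw_def)
    \<comment> \<open>\<open>?f w\<close> is extensional for every w, so the extensionality of w
      itself has to come from the space.\<close>
    finally have "?f w \<in> cube ?I \<and> w \<in> space ?M \<longleftrightarrow> w \<in> cube ?I"
      unfolding cube_def space_PiM PiE_iff by auto
    moreover have "sorted_wrt (\<lambda>a b. ?f w b < ?f w a) \<sigma> \<longleftrightarrow> sorted_wrt (\<lambda>a b. w b < w a) \<tau>"
      using n nth by (auto simp: sorted_wrt_iff_nth_less n_def)
    ultimately show "w \<in> ?f -` sector_region \<sigma> \<inter> space ?M \<longleftrightarrow> w \<in> sector_region \<tau>"
      using assms(3) by (auto simp: sector_region_def)
  qed
  then have "emeasure (distr ?M ?M ?f) (sector_region \<sigma>) = emeasure ?M (sector_region \<tau>)"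
    using f by (subst emeasure_distr) auto
  then show ?thesis
    using distr_PiM_lborel_reindex[OF _ \<pi>] by simp
qed

text \<open>The sorted list of values is determined by its set, and strict decrease makes w
  injective on the entries, so the entries can be recovered from their values.\<close>

lemma sorted_wrt_key_unique:
  fixes w :: "'i \<Rightarrow> real"
  assumes "sorted_wrt (\<lambda>a b. w b < w a) \<sigma>" "sorted_wrt (\<lambda>a b. w b < w a) \<tau>" "set \<sigma> = set \<tau>"
  shows "\<sigma> = \<tau>"
proof -
  have "rev (map w \<sigma>) = rev (map w \<tau>)"
    using assms by (intro strict_sorted_equal) (auto simp: sorted_wrt_rev sorted_wrt_map)
  then have "map w \<sigma> = map w \<tau>"
    by simp
  moreover have "inj_on w (set \<sigma> \<union> set \<tau>)"
  proof -
    have "a = b" if ab: "a \<in> set \<sigma>" "b \<in> set \<sigma>" "w a = w b" for a b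
    proof -
      obtain i j where "i < length \<sigma>" "\<sigma> ! i = a" "j < length \<sigma>" "\<sigma> ! j = b"
        using ab(1,2) by (metis in_set_conv_nth)
      then show ?thesis
        using assms(1) ab(3) unfolding sorted_wrt_iff_nth_less
        by (metis less_irrefl linorder_neqE_nat)
    qed
    then show ?thesis
      using assms(3) by (auto simp: inj_on_def)
  qed
  ultimately show ?thesis
    using inj_on_map_eq_map by blast
qed

text \<open>Sort the values and pull them back along the inverse of w. This puts every point of the
  cube without ties into some sector region.\<close>

lemma ex_sorted_wrt_key:
  fixes w :: "'i \<Rightarrow> real"
  assumes "finite I" "inj_on w I"
  shows "\<exists>\<sigma>\<in>permutations_of_set I. sorted_wrt (\<lambda>a b. w b < w a) \<sigma>"
proof -
  let ?g = "the_inv_into I w" and ?xs = "rev (sorted_list_of_set (w ` I))"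
  have xs: "set ?xs = w ` I" "distinct ?xs" "sorted_wrt (\<lambda>a b. b < a) ?xs"
    using assms(1) by (auto simp: sorted_wrt_rev)
  have w: "w (?g x) = x" if "x \<in> w ` I" for x
    using that assms(2) by (rule f_the_inv_into_f[rotated])
  have "sorted_wrt (\<lambda>a b. w (?g b) < w (?g a)) ?xs"
    using xs w by (intro sorted_wrt_mono_rel[OF _ xs(3)]) auto
  then have "sorted_wrt (\<lambda>a b. w b < w a) (map ?g ?xs)"
    by (simp add: sorted_wrt_map)
  moreover have "inj_on ?g (set ?xs)"
    unfolding xs(1) using assms(2) by (rule inj_on_the_inv_into)
  then have "map ?g ?xs \<in> permutations_of_set I"
    using xs assms(2) by (intro permutations_of_setI) (simp_all add: distinct_map the_inv_into_onto del: set_rev)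
  ultimately show ?thesis by blast
qed

text \<open>The regions of the sectors of \<open>I\<close> have equal volume and exhaust the cube up to ties, so each has
  volume \<open>1 / |I|!\<close>.\<close>

lemma emeasure_sector_event:
  fixes D :: "('i \<Rightarrow> real) set"
  assumes I: "finite I" and S: "S \<subseteq> permutations_of_set I"
    and D: "D \<in> sets (\<Pi>\<^sub>M i\<in>I. lborel)" "D \<subseteq> cube I"
    and iff: "\<And>\<sigma> w. \<sigma> \<in> permutations_of_set I \<Longrightarrow> w \<in> sector_region \<sigma> \<Longrightarrow> w \<in> D \<longleftrightarrow> \<sigma> \<in> S"
  shows "emeasure (\<Pi>\<^sub>M i\<in>I. lborel) D = ennreal (card S / fact (card I))"
proof -
  let ?M = "\<Pi>\<^sub>M i\<in>I. lborel :: real measure"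
  let ?P = "permutations_of_set I"
  have set: "set \<sigma> = I" "distinct \<sigma>" if "\<sigma> \<in> ?P" for \<sigma>
    using permutations_of_setD[OF that] by auto
  have sets: "sector_region \<sigma> \<in> sets ?M" if "\<sigma> \<in> ?P" for \<sigma>
    using sector_region_sets[of \<sigma>] set[OF that] by simp
  have union: "emeasure ?M (\<Union>\<sigma>\<in>S'. sector_region \<sigma>) = (\<Sum>\<sigma>\<in>S'. emeasure ?M (sector_region \<sigma>))"
    if "S' \<subseteq> ?P" for S'
  proof (rule sum_emeasure[symmetric])
    show "disjoint_family_on sector_region S'"
      unfolding disjoint_family_on_def
    proof (intro ballI impI)
      fix \<sigma> \<tau> assume st: "\<sigma> \<in> S'" "\<tau> \<in> S'" "\<sigma> \<noteq> \<tau>"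
      have "set \<sigma> = set \<tau>"
        using st that set(1) by blast
      then show "sector_region \<sigma> \<inter> sector_region \<tau> = {}"
        using sorted_wrt_key_unique st(3) by (fastforce simp: sector_region_def)
    qed
    show "sector_region ` S' \<subseteq> sets ?M" "finite S'"
      using sets that finite_subset[OF that] by auto
  qed
  \<comment> \<open>Points of A with ties lie in no region, so the two sets agree only almost
    everywhere.\<close>
  have cover: "emeasure ?M A = emeasure ?M (\<Union>\<sigma>\<in>S'. sector_region \<sigma>)"
    if A: "A \<in> sets ?M" "A \<subseteq> cube I" and S': "S' \<subseteq> ?P"
      and A_iff: "\<And>\<sigma> w. \<sigma> \<in> ?P \<Longrightarrow> w \<in> sector_region \<sigma> \<Longrightarrow> w \<in> A \<longleftrightarrow> \<sigma> \<in> S'" for A S'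
  proof (rule emeasure_eq_AE)
    show "AE w in ?M. w \<in> A \<longleftrightarrow> w \<in> (\<Union>\<sigma>\<in>S'. sector_region \<sigma>)"
      using AE_PiM_lborel_inj_on[OF I]
    proof eventually_elim
      case (elim w)
      show ?case
      proof
        assume w: "w \<in> A"
        obtain \<sigma> where \<sigma>: "\<sigma> \<in> ?P" "sorted_wrt (\<lambda>a b. w b < w a) \<sigma>"
          using ex_sorted_wrt_key[OF I elim] by blast
        then have "w \<in> sector_region \<sigma>"
          using w A(2) set by (auto simp: sector_region_def)
        then show "w \<in> (\<Union>\<sigma>\<in>S'. sector_region \<sigma>)"
          using A_iff \<sigma>(1) w by blast
      next
        assume "w \<in> (\<Union>\<sigma>\<in>S'. sector_region \<sigma>)"
        then show "w \<in> A"
          using A_iff S' by blast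
      qed
    qed
    show "(\<Union>\<sigma>\<in>S'. sector_region \<sigma>) \<in> sets ?M"
      using sets S' finite_subset[OF S'] by auto
  qed (fact A(1))
  obtain \<sigma>\<^sub>0 where \<sigma>\<^sub>0: "\<sigma>\<^sub>0 \<in> ?P"
    using I permutations_of_set_empty_iff[of I] by blast
  define c where "c = emeasure ?M (sector_region \<sigma>\<^sub>0)"
  have c: "emeasure ?M (sector_region \<sigma>) = c" if "\<sigma> \<in> ?P" for \<sigma>
    using emeasure_sector_region_eq[of \<sigma> \<sigma>\<^sub>0] set that \<sigma>\<^sub>0 by (simp add: c_def)
  \<comment> \<open>Stated for arbitrary A and S' because it is used twice: the cube with all
    permutations determines c, and then D with S gives the claim.\<close>
  have event: "emeasure ?M A = of_nat (card S') * c"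
    if "A \<in> sets ?M" "A \<subseteq> cube I" "S' \<subseteq> ?P"
      and "\<And>\<sigma> w. \<sigma> \<in> ?P \<Longrightarrow> w \<in> sector_region \<sigma> \<Longrightarrow> w \<in> A \<longleftrightarrow> \<sigma> \<in> S'" for A S'
  proof -
    have "emeasure ?M A = (\<Sum>\<sigma>\<in>S'. emeasure ?M (sector_region \<sigma>))"
      using cover[OF that] union[OF that(3)] by simp
    also have "\<dots> = (\<Sum>\<sigma>\<in>S'. c)"
      using c that(3) by (intro sum.cong) auto
    finally show ?thesis by simp
  qed
  define N :: nat where "N = fact (card I)"
  have one: "of_nat N * c = 1"
    using event[of "cube I" ?P] emeasure_cube[OF I] cube_sets[OF I] set I
    by (auto simp: sector_region_def N_def)
  have "c \<noteq> \<infinity>"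
    using one by (auto simp: ennreal_mult_top N_def)
  then obtain r where r: "c = ennreal r" "r \<ge> 0"
    by (cases c) auto
  have "ennreal (real N * r) = ennreal 1"
    using one r by (simp add: ennreal_mult ennreal_of_nat_eq_real_of_nat)
  then have "real N * r = 1"
    using r(2) by (subst (asm) ennreal_inj) auto
  then have "r = 1 / fact (card I)"
    by (auto simp: N_def field_simps)
  then have "ennreal (card S / fact (card I)) = of_nat (card S) * c"
    using r by (simp add: ennreal_of_nat_eq_real_of_nat flip: ennreal_mult)
  then show ?thesis
    using event[OF D S iff] by simp
qed

text \<open>Fubini, with the coordinates in J innermost. Each bound \<open>P l\<close> involves
  coordinates in T only, so for fixed tree parameters the section of D is a box, with one side for
  each l in J.\<close>

lemma emeasure_below_min:
  fixes P :: "'i \<Rightarrow> 'i set"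
  assumes fin: "finite T" "finite J" and disj: "T \<inter> J = {}" and P: "\<And>l. l \<in> J \<Longrightarrow> P l \<subseteq> T"
  defines "D \<equiv> {w \<in> cube (T \<union> J). \<forall>l\<in>J. \<forall>l'\<in>P l. w l < w l'}"
  shows "D \<in> sets (\<Pi>\<^sub>M i\<in>T \<union> J. lborel)"
    and "emeasure (\<Pi>\<^sub>M i\<in>T \<union> J. lborel) D = (\<integral>\<^sup>+ w. indicator (cube T) w *
      (\<Prod>l\<in>J. ennreal (if P l = {} then 1 else Min (w ` P l))) \<partial>(\<Pi>\<^sub>M i\<in>T. lborel))"
proof -
  let ?M = "\<lambda>I. \<Pi>\<^sub>M i\<in>I. lborel :: real measure"
  have finP: "finite (P l)" if "l \<in> J" for l
    using fin(1) P[OF that] by (rule rev_finite_subset)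
  have "{w \<in> space (?M (T \<union> J)). \<forall>l\<in>J. \<forall>l'\<in>P l. w l < w l'} \<in> sets (?M (T \<union> J))"
  proof (intro sets.sets_Collect_finite_All fin finP)
    fix l l' assume l: "l \<in> J" "l' \<in> P l"
    then have "l \<in> T \<union> J" "l' \<in> T \<union> J"
      using P by auto
    then show "{w \<in> space (?M (T \<union> J)). w l < w l'} \<in> sets (?M (T \<union> J))"
      by measurable
  qed
  then have "cube (T \<union> J) \<inter> {w \<in> space (?M (T \<union> J)). \<forall>l\<in>J. \<forall>l'\<in>P l. w l < w l'} \<in> sets (?M (T \<union> J))"
    using fin by auto
  also have "cube (T \<union> J) \<inter> {w \<in> space (?M (T \<union> J)). \<forall>l\<in>J. \<forall>l'\<in>P l. w l < w l'} = D"
    using cube_subset_space by (auto simp: D_def)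
  finally show D: "D \<in> sets (?M (T \<union> J))" .
  have inner: "(\<integral>\<^sup>+ y. indicator D (merge T J (x, y)) \<partial>?M J) =
      indicator (cube T) x * (\<Prod>l\<in>J. ennreal (if P l = {} then 1 else Min (x ` P l)))"
    if x: "x \<in> space (?M T)" for x
  proof -
    define B where "B l = {0..1} \<inter> {y. \<forall>l'\<in>P l. y < x l'}" for l
    have merge: "merge T J (x, y) \<in> D \<longleftrightarrow> x \<in> cube T \<and> y \<in> Pi\<^sub>E J B" if y: "y \<in> space (?M J)" for y
    proof -
      have "merge T J (x, y) \<in> cube (T \<union> J) \<longleftrightarrow> x \<in> cube T \<and> y \<in> cube J"
        using x y disj by (auto simp: cube_def space_PiM PiE_iff merge_def extensional_def)
      moreover have "merge T J (x, y) l = y l" "\<forall>l'\<in>P l. merge T J (x, y) l' = x l'" if "l \<in> J" for l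
        using that disj P[OF that] by (auto simp: merge_def)
      then have "(\<forall>l\<in>J. \<forall>l'\<in>P l. merge T J (x, y) l < merge T J (x, y) l') \<longleftrightarrow> (\<forall>l\<in>J. \<forall>l'\<in>P l. y l < x l')"
        by simp
      ultimately show ?thesis
        using y by (auto simp: D_def B_def cube_def PiE_iff)
    qed
    \<comment> \<open>The length is claimed only for x in the cube, where the minimum lies between 0
      and 1; elsewhere the factor \<open>indicator (cube T) x\<close> vanishes.\<close>
    have B: "B l \<in> sets lborel \<and> (x \<in> cube T \<longrightarrow>
        emeasure lborel (B l) = ennreal (if P l = {} then 1 else Min (x ` P l)))" if l: "l \<in> J" for l
    proof (cases "P l = {}")
      case True
      then show ?thesis by (simp add: B_def)
    next
      case False
      define m where "m = Min (x ` P l)"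
      have "(\<forall>l'\<in>P l. y < x l') \<longleftrightarrow> y < m" for y
        using False finP[OF l] by (simp add: m_def)
      then have Bm: "B l = {0..1} \<inter> {..<m}"
        by (auto simp: B_def)
      have "emeasure lborel (B l) = ennreal m" if "x \<in> cube T"
      proof -
        have "m \<in> x ` P l"
          unfolding m_def using False finP[OF l] by (intro Min_in) auto
        then have "0 \<le> m" "m \<le> 1"
          using that P[OF l] by (auto simp: cube_def PiE_iff)
        then have "B l = {0..<m}"
          by (auto simp: Bm)
        then show ?thesis
          using \<open>0 \<le> m\<close> by simp
      qed
      then show ?thesis
        using False by (simp add: Bm m_def)
    qed
    have "(\<integral>\<^sup>+ y. indicator D (merge T J (x, y)) \<partial>?M J) =
        (\<integral>\<^sup>+ y. indicator (cube T) x * indicator (Pi\<^sub>E J B) y \<partial>?M J)"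
      using merge by (intro nn_integral_cong) (auto simp: indicator_def)
    also have "\<dots> = indicator (cube T) x * emeasure (?M J) (Pi\<^sub>E J B)"
      using B fin by (intro nn_integral_cmult_indicator sets_PiM_I_finite) auto
    also have "emeasure (?M J) (Pi\<^sub>E J B) = (\<Prod>l\<in>J. emeasure lborel (B l))"
      using B fin by (intro lborel_product.emeasure_PiM) auto
    also have "indicator (cube T) x * \<dots> =
        indicator (cube T) x * (\<Prod>l\<in>J. ennreal (if P l = {} then 1 else Min (x ` P l)))"
      using B by (cases "x \<in> cube T") (auto intro!: prod.cong)
    finally show ?thesis .
  qed
  have "emeasure (?M (T \<union> J)) D = (\<integral>\<^sup>+ w. indicator D w \<partial>?M (T \<union> J))"
    by (rule nn_integral_indicator[symmetric]) (rule D)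
  also have "\<dots> = (\<integral>\<^sup>+ x. (\<integral>\<^sup>+ y. indicator D (merge T J (x, y)) \<partial>?M J) \<partial>?M T)"
    using D by (intro lborel_product.product_nn_integral_fold fin disj) auto
  also have "\<dots> = (\<integral>\<^sup>+ w. indicator (cube T) w *
      (\<Prod>l\<in>J. ennreal (if P l = {} then 1 else Min (w ` P l))) \<partial>?M T)"
    by (rule nn_integral_cong) (rule inner)
  finally show "emeasure (?M (T \<union> J)) D = (\<integral>\<^sup>+ w. indicator (cube T) w *
      (\<Prod>l\<in>J. ennreal (if P l = {} then 1 else Min (w ` P l))) \<partial>?M T)" .
qed

theorem theorem2p1:
  fixes G :: "('v, 'e) multigraph" and T :: "'e set"
  assumes "finite_multigraph G" and "connected_multigraph G" and "spanning_tree G T"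
  shows "tree_weight G T =
    (LINT w:(\<Pi>\<^sub>E l\<in>T. {0..1})|(\<Pi>\<^sub>M l\<in>T. lborel). \<Prod>l\<in>edges G - T. path_min G T w l)"
proof -
  let ?M = "\<lambda>I. \<Pi>\<^sub>M l\<in>I. lborel :: real measure"
  define J where "J = edges G - T"
  define P where "P = separating_edges G T"
  define D where "D = {w \<in> cube (T \<union> J). \<forall>l\<in>J. \<forall>l'\<in>P l. w l < w l'}"
  \<comment> \<open>This is \<open>path_min\<close> on J, in the form delivered by
    \<open>emeasure_below_min\<close>: there \<open>P l\<close> is empty exactly for
    self-loops.\<close>
  define m where "m w l = (if P l = {} then 1 else Min (w ` P l))" for w :: "'e \<Rightarrow> real" and l
  define S where "S = {\<sigma> \<in> hepp_sectors G. leading_tree G \<sigma> = T}"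
  have "T \<subseteq> edges G" and finE: "finite (edges G)"
    using assms(1,3) by (auto simp: spanning_tree_def finite_multigraph_def)
  then have fin: "finite T" "finite J" "T \<inter> J = {}" and E: "T \<union> J = edges G"
    by (auto simp: J_def finite_subset)
  have P: "P l \<subseteq> T" "finite (P l)" for l
    using fin(1) by (auto simp: P_def separating_edges_def)
  have path_min: "path_min G T w l = m w l" if "l \<in> J" for w l
  proof (cases "is_loop G l")
    case True
    then show ?thesis
      by (simp add: path_min_def m_def P_def separating_edges_loop)
  next
    case False
    have l: "l \<in> edges G"
      using that by (simp add: J_def)
    show ?thesis
      using False separating_edges_nonempty[OF assms(1,3) l False]
        tree_path_eq_separating_edges[OF assms(1,3) l]
      by (simp add: path_min_def m_def P_def)
  qed
  have m_nonneg: "m w l \<ge> 0" if "w \<in> cube T" for w l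
  proof (cases "P l = {}")
    case False
    then have "m w l \<in> w ` P l"
      using P(2) by (simp add: m_def)
    then obtain l' where "l' \<in> T" "m w l = w l'"
      using P(1) by blast
    then show ?thesis
      using that by (auto simp: cube_def PiE_iff)
  qed (simp add: m_def)
  have m_meas [measurable]: "(\<lambda>w. m w l) \<in> borel_measurable (?M T)" for l
  proof (cases "P l = {}")
    case False
    have "(\<lambda>w. w l') \<in> borel_measurable (?M T)" if "l' \<in> P l" for l'
    proof -
      have "l' \<in> T"
        using that P(1) by blast
      then show ?thesis by measurable
    qed
    then show ?thesis
      using False P(2) by (simp add: m_def borel_measurable_Min)
  qed (simp add: m_def)
  note D = emeasure_below_min[OF fin, of P, OF P(1), folded D_def m_def]
  have "emeasure (?M (edges G)) D = ennreal (card S / fact (card (edges G)))"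
  proof (rule emeasure_sector_event[OF finE])
    show "S \<subseteq> permutations_of_set (edges G)"
      by (auto simp: S_def hepp_sectors_def)
    show "D \<in> sets (?M (edges G))" "D \<subseteq> cube (edges G)"
      using D(1) E by (auto simp: D_def)
    fix \<sigma> w assume \<sigma>: "\<sigma> \<in> permutations_of_set (edges G)" and w: "w \<in> sector_region \<sigma>"
    then have "set \<sigma> = edges G" "sorted_wrt (\<lambda>a b. w b < w a) \<sigma>" "w \<in> cube (edges G)"
      by (auto simp: sector_region_def dest: permutations_of_setD)
    then show "w \<in> D \<longleftrightarrow> \<sigma> \<in> S"
      using leading_tree_eq_iff[OF assms(1,3), of \<sigma> w] \<sigma> E
      by (simp add: D_def S_def J_def P_def hepp_sectors_def)
  qed
  moreover have "card S / fact (card (edges G)) = tree_weight G T"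
    by (simp add: S_def tree_weight_def num_sectors_def)
  ultimately have "ennreal (tree_weight G T) =
      (\<integral>\<^sup>+ w. indicator (cube T) w * (\<Prod>l\<in>J. ennreal (m w l)) \<partial>?M T)"
    using D(2) E by simp
  \<comment> \<open>Moving \<open>ennreal\<close> out of the product needs nonnegative factors,
    which the cube guarantees; off the cube both sides are 0.\<close>
  also have "\<dots> = (\<integral>\<^sup>+ w. ennreal (indicator (cube T) w * (\<Prod>l\<in>J. m w l)) \<partial>?M T)"
    using m_nonneg by (intro nn_integral_cong) (auto simp: indicator_def prod_ennreal)
  finally have *: "ennreal (tree_weight G T) = \<dots>" .
  have "(LINT w:cube T|?M T. \<Prod>l\<in>J. path_min G T w l) = (LINT w|?M T. indicator (cube T) w * (\<Prod>l\<in>J. m w l))"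
    using path_min by (simp add: set_lebesgue_integral_def)
  \<comment> \<open>If the nonnegative integral were infinite, both sides would be 0 by convention;
    \<open>*\<close> shows that it is the finite number \<open>tree_weight G T\<close>.\<close>
  also have "\<dots> = enn2real (\<integral>\<^sup>+ w. ennreal (indicator (cube T) w * (\<Prod>l\<in>J. m w l)) \<partial>?M T)"
  proof (rule integral_eq_nn_integral)
    show "(\<lambda>w. indicator (cube T) w * (\<Prod>l\<in>J. m w l)) \<in> borel_measurable (?M T)"
      using cube_sets[OF fin(1)] by measurable
    show "AE w in ?M T. 0 \<le> indicator (cube T) w * (\<Prod>l\<in>J. m w l)"
      using m_nonneg by (intro AE_I2) (auto simp: indicator_def intro: prod_nonneg)
  qed
  also have "\<dots> = tree_weight G T"
    using *[symmetric] by (simp add: tree_weight_def)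
  finally show ?thesis
    by (simp add: cube_def J_def)
qed

end
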